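(* For every integer $n\ge 1$ and all $u,w\in S_\infty$, the skew Schubert polynomial $$u^{-1}\,\partial_u^w\bigl(\mathfrak{S}_{w_0(n)}(x)\bigr)$$ is a polynomial in the variables $x_i$ with nonnegative integer coefficients.
   Context: $\mathbb{N}=\{1,2,3,\dots\}$. $S_\infty$ is the group of bijections $\mathbb{N}\to\mathbb{N}$ fixing all but finitely many elements, with product $(uv)(i)=u(v(i))$ and identity $1$. $s_i$ ($i\ge 1$) is the transposition of $i$ and $i+1$. $\ell(u)$ is the number of pairs $i<j$ with $u(i)>u(j)$. $S_\infty$ acts on $\mathbb{Z}[x]=\mathbb{Z}[x_1,x_2,\dots]$ by ring automorphisms with $u(x_j)=x_{u(j)}$. The divided difference operators are $\partial^{s_i}(P)=\frac{P-s_i(P)}{x_i-x_{i+1}}$. $w_0(n)$ is the longest element of $S_{n+1}$ ($w_0(n)(i)=n+2-i$ for $i\le n+1$, and $w_0(n)(i)=i$ for $i>n+1$), and $\mathfrak{S}_{w_0(n)}(x)=\prod_{i=1}^{n}x_i^{\,n+1-i}$. The skew divided difference operators $\partial_u^w$ ($u,w\in S_\infty$), acting on polynomials in $x$, are characterized by the generalized Leibniz formula $\partial^w(PQ)=\sum_u\partial^u(P)\,\partial_u^w(Q)$, where $\partial^u=\partial^{s_{i_1}}\cdots\partial^{s_{i_m}}$ for any reduced word $u=s_{i_1}\cdots s_{i_m}$, $m=\ell(u)$. They satisfy, and are determined by, the following recurrence: $\partial_1^1=1$ (the identity operator); $\partial_u^1=0$ if $u\ne1$; and whenever $\ell(ws_i)<\ell(w)$,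 $$\partial_u^w=\partial_u^{ws_i}\partial^{s_i}+\partial_{us_i}^{ws_i}s_i\ \text{ if }\ell(us_i)<\ell(u),\qquad \partial_u^w=\partial_u^{ws_i}\partial^{s_i}\ \text{ if }\ell(us_i)>\ell(u),$$ where products of operators are compositions (rightmost applied first). The skew Schubert polynomials (in the sense of Kirillov) are the polynomials $u^{-1}\partial_u^w(\mathfrak{S}_{w_0(n)}(x))$, i.e. the permutation $u^{-1}$ applied to the variables of $\partial_u^w(\mathfrak{S}_{w_0(n)}(x))$. *)

theory Defs
  imports "HOL-Library.Poly_Mapping" "HOL-Combinatorics.Permutations"
begin

section \<open>The group of finitely supported permutations of the positive integers\<close>

text \<open>Elements are functions on \<^typ>\<open>nat\<close> that fix \<open>0\<close>, so that the indices are
  \<open>1, 2, 3, \<dots>\<close>; the product \<open>u v\<close> is \<open>u \<circ> v\<close>.\<close>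

definition S_inf :: "(nat \<Rightarrow> nat) set" where
  "S_inf = {u. u permutes {1..} \<and> finite {i. u i \<noteq> i}}"

definition s :: "nat \<Rightarrow> nat \<Rightarrow> nat" where
  "s i = transpose i (Suc i)"

definition len :: "(nat \<Rightarrow> nat) \<Rightarrow> nat" where
  "len u = card {(i, j). 1 \<le> i \<and> i < j \<and> u i > u j}"

lemma S_inf_bij: "u \<in> S_inf \<Longrightarrow> bij u"
  by (auto simp: S_inf_def permutes_bij)

lemma S_inf_inj: "u \<in> S_inf \<Longrightarrow> inj u"
  by (simp add: S_inf_bij bij_is_inj)

lemma S_inf_zero: "u \<in> S_inf \<Longrightarrow> u 0 = 0"
  by (auto simp: S_inf_def permutes_def)

lemma S_inf_pos: "u \<in> S_inf \<Longrightarrow> 1 \<le> i \<Longrightarrow> 1 \<le> u i"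
  by (metis S_inf_zero S_inf_inj injD less_one not_le)

lemma id_in_S_inf [simp]: "id \<in> S_inf"
  by (simp add: S_inf_def permutes_id)

lemma S_inf_comp [intro]:
  assumes "u \<in> S_inf" "v \<in> S_inf"
  shows "u \<circ> v \<in> S_inf"
proof -
  have "{i. (u \<circ> v) i \<noteq> i} \<subseteq> {i. u i \<noteq> i} \<union> {i. v i \<noteq> i}"
    by auto
  then show ?thesis
    using assms by (auto simp: S_inf_def intro: permutes_compose finite_subset)
qed

lemma S_inf_inv [intro]:
  assumes "u \<in> S_inf"
  shows "inv u \<in> S_inf"
proof -
  have "{i. inv u i \<noteq> i} = {i. u i \<noteq> i}"
    using S_inf_bij[OF assms] by (metis bij_inv_eq_iff)
  then show ?thesis
    using assms by (auto simp: S_inf_def intro: permutes_inv)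
qed

lemma s_apply: "s i j = (if j = i then Suc i else if j = Suc i then i else j)"
  by (simp add: s_def transpose_def)

lemma s_in_S_inf [simp]: "1 \<le> i \<Longrightarrow> s i \<in> S_inf"
proof -
  assume "1 \<le> i"
  moreover have "{j. s i j \<noteq> j} \<subseteq> {i, Suc i}"
    by (auto simp: s_apply)
  ultimately show ?thesis
    by (auto simp: S_inf_def s_def intro: permutes_swap_id finite_subset)
qed

lemma s_s [simp]: "s i (s i j) = j"
  by (simp add: s_def)

lemma bij_s [simp]: "bij (s i)"
  by (simp add: s_def)

lemma s_comp_s [simp]: "s i \<circ> s i = id"
  by (simp add: s_def)

lemma comp_s_s [simp]: "(u \<circ> s i) \<circ> s i = u"
  by (simp add: fun_eq_iff)

lemma inversions_finite:
  assumes "u \<in> S_inf"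
  shows "finite {(i, j). 1 \<le> i \<and> i < j \<and> u i > u j}"
proof -
  obtain N where N: "\<And>i. u i \<noteq> i \<Longrightarrow> i \<le> N"
    using assms by (auto simp: S_inf_def finite_nat_set_iff_bounded_le)
  have "u i \<le> N" if "i \<le> N" for i
    using N[of "u i"] that S_inf_inj[OF assms] by (metis injD linear)
  then have "{(i, j). 1 \<le> i \<and> i < j \<and> u i > u j} \<subseteq> {..N} \<times> {..N}"
    using N by (auto simp: not_le) (metis le_less_trans less_imp_le not_le order.trans)+
  then show ?thesis
    by (rule finite_subset) auto
qed

lemma len_s_ascent:
  assumes u: "u \<in> S_inf" and i: "1 \<le> i" and asc: "u i < u (Suc i)"
  shows "len (u \<circ> s i) = Suc (len u)"
proof -
  let ?I = "\<lambda>u :: nat \<Rightarrow> nat. {(a, b). 1 \<le> a \<and> a < b \<and> u a > u b}"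
  let ?f = "map_prod (s i) (s i)"
  have mem: "(s i a, s i b) \<in> ?I (u \<circ> s i)" if "(a, b) \<in> ?I u" for a b
    using that asc i by (auto simp: s_apply)
  have mem': "(s i a, s i b) \<in> ?I u" if "(a, b) \<in> ?I (u \<circ> s i)" "(a, b) \<noteq> (i, Suc i)" for a b
    using that asc i by (auto simp: s_apply split: if_splits)
  have "?I (u \<circ> s i) = insert (i, Suc i) (?f ` ?I u)"
  proof (intro equalityI subsetI)
    fix p assume p: "p \<in> ?I (u \<circ> s i)"
    obtain a b where ab: "p = (a, b)" by (cases p)
    show "p \<in> insert (i, Suc i) (?f ` ?I u)"
    proof (cases "p = (i, Suc i)")
      case False
      then have "(s i a, s i b) \<in> ?I u" using mem' p ab by blast
      then have "?f (s i a, s i b) \<in> ?f ` ?I u" by (rule imageI)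
      then show ?thesis by (simp add: ab)
    qed simp
  next
    fix p assume "p \<in> insert (i, Suc i) (?f ` ?I u)"
    then consider "p = (i, Suc i)" | a b where "p = (s i a, s i b)" "(a, b) \<in> ?I u"
      by auto
    then show "p \<in> ?I (u \<circ> s i)"
    proof cases
      case 1
      then show ?thesis using asc i by (simp add: s_apply)
    next
      case 2
      then show ?thesis using mem by blast
    qed
  qed
  moreover have "(i, Suc i) \<notin> ?f ` ?I u"
  proof
    assume "(i, Suc i) \<in> ?f ` ?I u"
    then obtain a b where "(i, Suc i) = (s i a, s i b)" "(a, b) \<in> ?I u" by auto
    then show False using asc by (auto simp: s_apply split: if_splits)
  qed
  moreover have "inj_on ?f (?I u)"
    by (rule inj_on_inverseI[where g = ?f]) auto
  ultimately show ?thesis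
    using inversions_finite[OF u] by (simp add: len_def card_image)
qed

lemma len_s_descent:
  assumes u: "u \<in> S_inf" and i: "1 \<le> i" and des: "u (Suc i) < u i"
  shows "len u = Suc (len (u \<circ> s i))"
proof -
  have "u \<circ> s i \<in> S_inf"
    using u i by auto
  moreover have "(u \<circ> s i) i < (u \<circ> s i) (Suc i)"
    using des by (simp add: s_apply)
  ultimately show ?thesis
    using len_s_ascent[of "u \<circ> s i" i] i by (simp only: comp_s_s)
qed

lemma S_inf_neq: "u \<in> S_inf \<Longrightarrow> u i \<noteq> u (Suc i)"
  using S_inf_inj[of u] by (metis injD n_not_Suc_n)

lemma len_s_less_iff:
  assumes "u \<in> S_inf" "1 \<le> i"
  shows "len (u \<circ> s i) < len u \<longleftrightarrow> u (Suc i) < u i"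
  using len_s_ascent[OF assms] len_s_descent[OF assms] S_inf_neq[OF assms(1), of i]
  by (metis Suc_lessD lessI linorder_neqE_nat not_less_iff_gr_or_eq)

lemma len_s_greater_iff:
  assumes "u \<in> S_inf" "1 \<le> i"
  shows "len u < len (u \<circ> s i) \<longleftrightarrow> u i < u (Suc i)"
  using len_s_ascent[OF assms] len_s_descent[OF assms] S_inf_neq[OF assms(1), of i]
  by (metis Suc_lessD lessI linorder_neqE_nat not_less_iff_gr_or_eq)

lemma ex_descent:
  assumes u: "u \<in> S_inf" and "u \<noteq> id"
  shows "\<exists>i\<ge>1. u (Suc i) < u i"
proof (rule ccontr)
  assume "\<not> ?thesis"
  then have asc: "u i < u (Suc i)" for i
    using S_inf_neq[OF u, of i] S_inf_zero[OF u] S_inf_pos[OF u, of 1]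
    by (cases "i = 0") (auto simp: linorder_neq_iff)
  then have mono: "strict_mono u"
    by (simp add: strict_mono_Suc_iff)
  have "u i = i" for i
  proof (induction i rule: less_induct)
    case (less i)
    obtain k where k: "u k = i"
      using S_inf_bij[OF u] by (metis bij_pointE)
    have "\<not> k < i" using less[of k] k by auto
    moreover have "\<not> i < k"
      using mono k strict_mono_imp_increasing[OF mono, of i]
      by (metis leD strict_monoD)
    ultimately show ?case using k by auto
  qed
  then show False using \<open>u \<noteq> id\<close> by auto
qed

section \<open>Polynomials and divided differences\<close>

text \<open>A monomial is its finitely supported exponent vector, a polynomial the finitely
  supported family of its coefficients. The type has a spare variable with index \<open>0\<close>;
  the ring of polynomials in \<open>x\<^sub>1, x\<^sub>2, \<dots>\<close> is the subset \<open>Zx\<close>.\<close>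

type_synonym mpoly_int = "(nat \<Rightarrow>\<^sub>0 nat) \<Rightarrow>\<^sub>0 int"

definition Zx :: "mpoly_int set" where
  "Zx = {P. \<forall>m \<in> Poly_Mapping.keys P. Poly_Mapping.keys m \<subseteq> {1..}}"

definition X :: "nat \<Rightarrow> mpoly_int" where
  "X i = Poly_Mapping.single (Poly_Mapping.single i 1) 1"

text \<open>The coefficient of the monomial \<open>m\<close> in \<open>u P\<close> is the coefficient of \<open>m \<circ> u\<close> in
  \<open>P\<close>; the lemmas \<open>act_const\<close>, \<open>act_X\<close>, \<open>act_add\<close>, \<open>act_mult\<close> below confirm that \<open>u\<close> acts
  as the ring automorphism with \<open>x\<^sub>j \<mapsto> x\<^bsub>u(j)\<^esub>\<close>.\<close>

definition act :: "(nat \<Rightarrow> nat) \<Rightarrow> mpoly_int \<Rightarrow> mpoly_int" where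
  "act u P = Poly_Mapping.map_key (Poly_Mapping.map_key u) P"

text \<open>The quotient is unique since the polynomials form an integral domain, and it
  exists (\<open>dd_eq\<close> below).\<close>

definition dd :: "nat \<Rightarrow> mpoly_int \<Rightarrow> mpoly_int" where
  "dd i P = (THE Q. (X i - X (Suc i)) * Q = P - act (s i) P)"

lemma mpoly_induct [consumes 1, case_names const var add mult]:
  fixes P :: mpoly_int
  assumes P: "\<forall>m \<in> Poly_Mapping.keys P. Poly_Mapping.keys m \<subseteq> J"
    and const: "\<And>c. R (Poly_Mapping.single 0 c)"
    and var: "\<And>j. j \<in> J \<Longrightarrow> R (X j)"
    and add: "\<And>P Q. R P \<Longrightarrow> R Q \<Longrightarrow> R (P + Q)"
    and mult: "\<And>P Q. R P \<Longrightarrow> R Q \<Longrightarrow> R (P * Q)"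
  shows "R P"
proof -
  have pow: "R (Poly_Mapping.single (Poly_Mapping.single j n) 1)" if "j \<in> J" for j n
  proof (induction n)
    case 0
    then show ?case using const[of 1] by simp
  next
    case (Suc n)
    have "Poly_Mapping.single (Poly_Mapping.single j (Suc n)) (1 :: int)
        = X j * Poly_Mapping.single (Poly_Mapping.single j n) 1"
      by (simp add: X_def mult_single single_add[symmetric])
    then show ?case using mult[OF var[OF that] Suc] by simp
  qed
  have upd: "Poly_Mapping.update a b f = Poly_Mapping.single a b + f"
    if "a \<notin> Poly_Mapping.keys f" for a :: 'a and b :: "'b :: comm_monoid_add" and f
    using that by (intro poly_mapping_eqI)
      (auto simp: lookup_update lookup_add lookup_single when_def in_keys_iff)
  have mon: "R (Poly_Mapping.single m 1)" if "Poly_Mapping.keys m \<subseteq> J" for m :: "nat \<Rightarrow>\<^sub>0 nat"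
    using that
  proof (induction m rule: update_induct)
    case const
    then show ?case using assms(2)[of 1] by simp
  next
    case (update f a b)
    have "Poly_Mapping.single (Poly_Mapping.update a b f) (1 :: int)
        = Poly_Mapping.single (Poly_Mapping.single a b) 1 * Poly_Mapping.single f 1"
      by (simp add: mult_single upd update)
    moreover have "a \<in> J" "Poly_Mapping.keys f \<subseteq> J"
      using update by (auto simp: keys_update)
    ultimately show ?case using mult[OF pow update.IH] by simp
  qed
  show ?thesis
    using P
  proof (induction P rule: update_induct)
    case const
    then show ?case using assms(2)[of 0] by simp
  next
    case (update f a b)
    have "Poly_Mapping.single a b = Poly_Mapping.single 0 b * Poly_Mapping.single a (1 :: int)"
      by (simp add: mult_single)
    moreover have "Poly_Mapping.keys a \<subseteq> J"
        "\<forall>m \<in> Poly_Mapping.keys f. Poly_Mapping.keys m \<subseteq> J"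
      using update by (auto simp: keys_update)
    ultimately show ?case
      using add[OF mult[OF assms(2) mon] update.IH] update.hyps by (simp add: upd)
  qed
qed

lemma mpoly_induct_UNIV [case_names const var add mult]:
  fixes P :: mpoly_int
  assumes "\<And>c. R (Poly_Mapping.single 0 c)" "\<And>j. R (X j)"
    and "\<And>P Q. R P \<Longrightarrow> R Q \<Longrightarrow> R (P + Q)" "\<And>P Q. R P \<Longrightarrow> R Q \<Longrightarrow> R (P * Q)"
  shows "R P"
  by (rule mpoly_induct[where J = UNIV]) (use assms in auto)

lemma Zx_induct [consumes 1, case_names const var add mult]:
  assumes "P \<in> Zx" "\<And>c. R (Poly_Mapping.single 0 c)" "\<And>j. 1 \<le> j \<Longrightarrow> R (X j)"
    and "\<And>P Q. R P \<Longrightarrow> R Q \<Longrightarrow> R (P + Q)" "\<And>P Q. R P \<Longrightarrow> R Q \<Longrightarrow> R (P * Q)"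
  shows "R P"
  by (rule mpoly_induct[where J = "{1..}"]) (use assms in \<open>auto simp: Zx_def\<close>)

lemma inj_map_key:
  assumes "bij u"
  shows "inj (Poly_Mapping.map_key u :: ('a \<Rightarrow>\<^sub>0 'b :: zero) \<Rightarrow> _)"
proof (rule injI, rule poly_mapping_eqI)
  fix m m' :: "'a \<Rightarrow>\<^sub>0 'b" and k
  assume "Poly_Mapping.map_key u m = Poly_Mapping.map_key u m'"
  then have "Poly_Mapping.lookup (Poly_Mapping.map_key u m) (inv u k)
      = Poly_Mapping.lookup (Poly_Mapping.map_key u m') (inv u k)"
    by simp
  then show "Poly_Mapping.lookup m k = Poly_Mapping.lookup m' k"
    using assms by (simp add: map_key.rep_eq bij_is_inj bij_is_surj surj_f_inv_f)
qed

lemma lookup_act: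
  assumes "bij u"
  shows "Poly_Mapping.lookup (act u P) m = Poly_Mapping.lookup P (Poly_Mapping.map_key u m)"
  by (simp add: act_def map_key.rep_eq inj_map_key assms)

lemma act_add: "bij u \<Longrightarrow> act u (P + Q) = act u P + act u Q"
  by (simp add: poly_mapping_eq_iff fun_eq_iff lookup_act lookup_add)

lemma act_0: "bij u \<Longrightarrow> act u 0 = 0"
  by (simp add: poly_mapping_eq_iff fun_eq_iff lookup_act)

lemma act_uminus: "bij u \<Longrightarrow> act u (- P) = - act u P"
  by (simp add: poly_mapping_eq_iff fun_eq_iff lookup_act)

lemma act_diff: "bij u \<Longrightarrow> act u (P - Q) = act u P - act u Q"
  by (simp add: poly_mapping_eq_iff fun_eq_iff lookup_act lookup_minus)

lemma map_key_inv:
  assumes "bij u"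
  shows "Poly_Mapping.map_key u (Poly_Mapping.map_key (inv u) m) = m"
    and "Poly_Mapping.map_key (inv u) (Poly_Mapping.map_key u m) = m"
  using assms bij_imp_bij_inv[OF assms]
  by (auto intro!: poly_mapping_eqI simp: map_key.rep_eq bij_is_inj bij_is_surj surj_f_inv_f)

lemma act_single:
  assumes "bij u"
  shows "act u (Poly_Mapping.single m c) = Poly_Mapping.single (Poly_Mapping.map_key (inv u) m) c"
proof (rule poly_mapping_eqI)
  fix k
  have "m = Poly_Mapping.map_key u k \<longleftrightarrow> Poly_Mapping.map_key (inv u) m = k"
    using map_key_inv[OF assms] by metis
  then show "Poly_Mapping.lookup (act u (Poly_Mapping.single m c)) k
      = Poly_Mapping.lookup (Poly_Mapping.single (Poly_Mapping.map_key (inv u) m) c) k"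
    by (simp add: lookup_act assms lookup_single)
qed

lemma act_const: "bij u \<Longrightarrow> act u (Poly_Mapping.single 0 c) = Poly_Mapping.single 0 c"
  by (simp add: act_single map_key_zero bij_is_inj bij_imp_bij_inv)

lemma act_1: "bij u \<Longrightarrow> act u 1 = 1"
  using act_const[of u 1] by simp

lemma act_X:
  assumes "bij u"
  shows "act u (X j) = X (u j)"
proof -
  have "Poly_Mapping.map_key (inv u) (Poly_Mapping.single j (1 :: nat)) = Poly_Mapping.single (u j) 1"
    using map_key_single[of "inv u" "u j" "1 :: nat"] assms
    by (simp add: bij_is_inj bij_imp_bij_inv)
  then show ?thesis by (simp add: X_def act_single assms)
qed

lemma act_mult:
  assumes "bij u"
  shows "act u (P * Q) = act u P * act u Q"
proof -
  have ss: "act u (Poly_Mapping.single m c * Poly_Mapping.single n d)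
      = act u (Poly_Mapping.single m c) * act u (Poly_Mapping.single n d)" for m n c d
    using assms
    by (simp add: mult_single act_single map_key_plus bij_is_inj bij_imp_bij_inv)
  have upd: "Poly_Mapping.update a b f = Poly_Mapping.single a b + f"
    if "a \<notin> Poly_Mapping.keys f" for a and b and f :: mpoly_int
    using that by (intro poly_mapping_eqI)
      (auto simp: lookup_update lookup_add lookup_single when_def in_keys_iff)
  have sq: "act u (Poly_Mapping.single m c * Q) = act u (Poly_Mapping.single m c) * act u Q" for m c
  proof (induction Q rule: update_induct)
    case (update f a b)
    then show ?case using assms by (simp add: upd distrib_left act_add ss)
  qed (simp add: act_0 assms)
  show ?thesis
  proof (induction P rule: update_induct)
    case (update f a b)
    then show ?case using assms by (simp add: upd distrib_right act_add sq)
  qed (simp add: act_0 assms)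
qed

lemma act_comp:
  assumes "bij u" "bij v"
  shows "act (u \<circ> v) P = act u (act v P)"
proof -
  have "Poly_Mapping.map_key (u \<circ> v) m = Poly_Mapping.map_key v (Poly_Mapping.map_key u m)"
      for m :: "nat \<Rightarrow>\<^sub>0 nat"
    using assms by (simp add: map_key_compose bij_is_inj)
  then show ?thesis
    using assms by (intro poly_mapping_eqI) (simp add: lookup_act bij_comp)
qed

lemma act_id [simp]: "act id P = P"
proof (rule poly_mapping_eqI)
  fix m :: "nat \<Rightarrow>\<^sub>0 nat"
  have "Poly_Mapping.map_key id m = m"
    using map_key_id[of m] by (simp only: id_def)
  then show "Poly_Mapping.lookup (act id P) m = Poly_Mapping.lookup P m"
    by (simp add: lookup_act)
qed

lemma Zx_mult:
  assumes "P \<in> Zx" "Q \<in> Zx"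
  shows "P * Q \<in> Zx"
  unfolding Zx_def
proof safe
  fix m k assume m: "m \<in> Poly_Mapping.keys (P * Q)" and k: "k \<in> Poly_Mapping.keys m"
  then obtain a b where "a \<in> Poly_Mapping.keys P" "b \<in> Poly_Mapping.keys Q" "m = a + b"
    using keys_mult[of P Q] by auto
  moreover have "k \<in> Poly_Mapping.keys a \<union> Poly_Mapping.keys b"
    using k keys_add[of a b] calculation by auto
  ultimately show "1 \<le> k" using assms by (fastforce simp: Zx_def)
qed

lemma Zx_add: "P \<in> Zx \<Longrightarrow> Q \<in> Zx \<Longrightarrow> P + Q \<in> Zx"
  using keys_add[of P Q] unfolding Zx_def by blast

lemma Zx_const [simp]: "Poly_Mapping.single 0 c \<in> Zx"
  by (simp add: Zx_def)

lemma Zx_X [simp]: "1 \<le> j \<Longrightarrow> X j \<in> Zx"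
  by (simp add: Zx_def X_def)

lemma Zx_0 [simp]: "0 \<in> Zx" and Zx_1 [simp]: "1 \<in> Zx"
  by (simp_all add: Zx_def)

lemma Zx_act:
  assumes "P \<in> Zx" and u: "u \<in> S_inf"
  shows "act u P \<in> Zx"
  using assms(1)
proof (induction P rule: Zx_induct)
  case (var j)
  then show ?case using u S_inf_pos[OF u, of j] by (simp add: act_X S_inf_bij del: One_nat_def)
qed (use u in \<open>auto simp: act_const act_add act_mult S_inf_bij intro: Zx_add Zx_mult\<close>)

lemma X_inj [simp]: "X i = X j \<longleftrightarrow> i = j"
proof
  assume "X i = X j"
  then have "Poly_Mapping.single i (1 :: nat) = Poly_Mapping.single j 1"
    by (simp add: X_def frag_of_eq)
  then have "Poly_Mapping.keys (Poly_Mapping.single i (1 :: nat))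
      = Poly_Mapping.keys (Poly_Mapping.single j (1 :: nat))"
    by (rule arg_cong)
  then show "i = j" by simp
qed simp

lemma ex_dd:
  assumes "\<forall>m \<in> Poly_Mapping.keys P. Poly_Mapping.keys m \<subseteq> J"
    and C: "\<And>c. Poly_Mapping.single 0 c \<in> C" "\<And>j. j \<in> J \<Longrightarrow> X j \<in> C"
      "\<And>P Q. P \<in> C \<Longrightarrow> Q \<in> C \<Longrightarrow> P + Q \<in> C" "\<And>P Q. P \<in> C \<Longrightarrow> Q \<in> C \<Longrightarrow> P * Q \<in> C"
      "\<And>P. P \<in> C \<Longrightarrow> act (s i) P \<in> C"
  shows "\<exists>Q \<in> C. (X i - X (Suc i)) * Q = P - act (s i) P"
proof -
  have zero: "0 \<in> C" and one: "1 \<in> C" and mone: "-1 \<in> C"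
    using C(1)[of 0] C(1)[of 1] C(1)[of "-1"] by (simp_all add: single_uminus)
  have "P \<in> C \<and> (\<exists>Q \<in> C. (X i - X (Suc i)) * Q = P - act (s i) P)"
    using assms(1)
  proof (induction P rule: mpoly_induct)
    case (const c)
    then show ?case using C(1) zero by (auto intro!: bexI[of _ 0] simp: act_const)
  next
    case (var j)
    show ?case
    proof (cases "j = i \<or> j = Suc i")
      case False
      then have "act (s i) (X j) = X j" by (simp add: act_X s_apply)
      then show ?thesis using zero C(2) var by (auto intro!: bexI[of _ 0])
    next
      case True
      then show ?thesis
      proof
        assume "j = i"
        then have "act (s i) (X j) = X (Suc i)" by (simp add: act_X s_apply)
        then show ?thesis using one C(2) var \<open>j = i\<close> by (auto intro!: bexI[of _ 1])
      next
        assume "j = Suc i"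
        then have "act (s i) (X j) = X i" by (simp add: act_X s_apply)
        then show ?thesis using mone C(2) var \<open>j = Suc i\<close> by (auto intro!: bexI[of _ "-1"])
      qed
    qed
  next
    case (add P Q)
    then obtain P' Q' where *: "P' \<in> C" "Q' \<in> C"
      "(X i - X (Suc i)) * P' = P - act (s i) P" "(X i - X (Suc i)) * Q' = Q - act (s i) Q"
      by auto
    then have "(X i - X (Suc i)) * (P' + Q') = P + Q - act (s i) (P + Q)"
      by (simp add: distrib_left act_add)
    moreover have "P + Q \<in> C" "P' + Q' \<in> C" using C(3) add * by simp_all
    ultimately show ?case by blast
  next
    case (mult P Q)
    then obtain P' Q' where *: "P' \<in> C" "Q' \<in> C"
      "(X i - X (Suc i)) * P' = P - act (s i) P" "(X i - X (Suc i)) * Q' = Q - act (s i) Q"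
      by auto
    have "(X i - X (Suc i)) * (P * Q' + P' * act (s i) Q)
        = P * ((X i - X (Suc i)) * Q') + (X i - X (Suc i)) * P' * act (s i) Q"
      by (simp add: algebra_simps)
    also have "\<dots> = P * Q - act (s i) (P * Q)"
      unfolding * by (simp add: act_mult right_diff_distrib left_diff_distrib)
    finally have "(X i - X (Suc i)) * (P * Q' + P' * act (s i) Q) = P * Q - act (s i) (P * Q)" .
    moreover have "P * Q \<in> C" "P * Q' + P' * act (s i) Q \<in> C"
      using C(3-5) mult * by simp_all
    ultimately show ?case by blast
  qed
  then show ?thesis by blast
qed

lemma dd_unique:
  assumes "(X i - X (Suc i)) * Q = P - act (s i) P"
  shows "dd i P = Q"
  unfolding dd_def
proof (rule the_equality)
  show "(X i - X (Suc i)) * Q = P - act (s i) P" by (rule assms)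
  fix Q' assume "(X i - X (Suc i)) * Q' = P - act (s i) P"
  with assms have "(X i - X (Suc i)) * Q' = (X i - X (Suc i)) * Q" by simp
  then show "Q' = Q" by simp
qed

lemma dd_eq: "(X i - X (Suc i)) * dd i P = P - act (s i) P"
proof -
  obtain Q where "(X i - X (Suc i)) * Q = P - act (s i) P"
    using ex_dd[of P UNIV UNIV i] by auto
  then show ?thesis using dd_unique by blast
qed

lemma dd_in_Zx:
  assumes "P \<in> Zx" "1 \<le> i"
  shows "dd i P \<in> Zx"
proof -
  have "\<forall>m \<in> Poly_Mapping.keys P. Poly_Mapping.keys m \<subseteq> {1..}"
    using assms(1) by (simp add: Zx_def)
  then have "\<exists>Q \<in> Zx. (X i - X (Suc i)) * Q = P - act (s i) P"
    by (rule ex_dd) (use assms(2) in \<open>simp_all add: Zx_add Zx_mult Zx_act\<close>)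
  then show ?thesis using dd_unique by blast
qed

lemma dd_add: "dd i (P + Q) = dd i P + dd i Q"
  by (rule dd_unique) (simp add: distrib_left dd_eq act_add)

lemma dd_0 [simp]: "dd i 0 = 0"
  by (rule dd_unique) (simp add: act_0)

lemma act_s_s [simp]: "act (s i) (act (s i) P) = P"
  by (simp flip: act_comp)

lemma X_diff_nonzero: "i \<noteq> j \<Longrightarrow> X i - X j \<noteq> 0"
  by simp

lemma dd_dd [simp]: "dd i (dd i P) = 0"
proof -
  let ?A = "X i - X (Suc i)"
  have "act (s i) (?A * dd i P) = act (s i) (P - act (s i) P)"
    by (simp add: dd_eq)
  then have "- ?A * act (s i) (dd i P) = - (P - act (s i) P)"
    by (simp add: act_mult act_diff act_X s_apply)
  then have "?A * act (s i) (dd i P) = ?A * dd i P"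
    by (simp only: dd_eq mult_minus_left neg_equal_iff_equal)
  then have "act (s i) (dd i P) = dd i P" by simp
  then show ?thesis by (intro dd_unique) simp
qed

lemma dd_mult: "dd i (P * Q) = P * dd i Q + dd i P * act (s i) Q"
proof (rule dd_unique)
  have "(X i - X (Suc i)) * (P * dd i Q + dd i P * act (s i) Q)
      = P * ((X i - X (Suc i)) * dd i Q) + (X i - X (Suc i)) * dd i P * act (s i) Q"
    by (simp add: distrib_left mult_ac)
  also have "\<dots> = P * (Q - act (s i) Q) + (P - act (s i) P) * act (s i) Q"
    by (simp only: dd_eq)
  also have "\<dots> = P * Q - act (s i) (P * Q)"
    by (simp add: act_mult algebra_simps)
  finally show "(X i - X (Suc i)) * (P * dd i Q + dd i P * act (s i) Q) = P * Q - act (s i) (P * Q)" .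
qed

lemma act_dd:
  assumes "bij g" "g i = k" "g (Suc i) = Suc k"
  shows "act g (dd i P) = dd k (act g P)"
proof (rule dd_unique[symmetric])
  have "g x = k \<longleftrightarrow> x = i" "g x = Suc k \<longleftrightarrow> x = Suc i" for x
    using assms bij_is_inj[OF assms(1)] by (metis injD)+
  then have "g \<circ> s i = s k \<circ> g"
    using assms by (simp add: fun_eq_iff s_apply)
  then have "act g (act (s i) P) = act (s k) (act g P)"
    using assms by (metis act_comp bij_s)
  moreover have "act g ((X i - X (Suc i)) * dd i P) = act g (P - act (s i) P)"
    by (simp add: dd_eq)
  ultimately show "(X k - X (Suc k)) * act g (dd i P) = act g P - act (s k) (act g P)"
    using assms by (simp add: act_mult act_diff act_X)
qed

lemma act_far:
  assumes "Suc i < j \<or> Suc j < i"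
  shows "act (s i) (act (s j) P) = act (s j) (act (s i) P)"
proof -
  have "s i \<circ> s j = s j \<circ> s i"
    using assms by (auto simp: fun_eq_iff s_apply)
  then show ?thesis by (metis act_comp bij_s)
qed

lemma act_dd_far:
  assumes "Suc i < j \<or> Suc j < i"
  shows "act (s i) (dd j P) = dd j (act (s i) P)"
  by (rule act_dd) (use assms in \<open>auto simp: s_apply\<close>)

lemma dd_far:
  assumes "Suc i < j \<or> Suc j < i"
  shows "dd i (dd j P) = dd j (dd i P)"
proof (rule dd_unique)
  let ?A = "X i - X (Suc i)" and ?B = "X j - X (Suc j)"
  have "?B * (?A * dd j (dd i P)) = ?A * (dd i P - act (s j) (dd i P))"
    by (simp only: dd_eq mult.left_commute)
  also have "\<dots> = ?A * dd i P - ?A * dd i (act (s j) P)"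
    using assms by (simp add: act_dd_far right_diff_distrib disj_commute)
  also have "\<dots> = P - act (s i) P - (act (s j) P - act (s i) (act (s j) P))"
    by (simp only: dd_eq)
  also have "\<dots> = ?B * dd j P - ?B * dd j (act (s i) P)"
    using act_far[OF assms] by (simp add: dd_eq)
  also have "\<dots> = ?B * (dd j P - act (s i) (dd j P))"
    using assms by (simp add: act_dd_far right_diff_distrib)
  finally show "?A * dd j (dd i P) = dd j P - act (s i) (dd j P)"
    by simp
qed

context
  fixes i j :: nat
  assumes j: "j = Suc i"
begin

lemma act_X_braid:
  "act (s i) (X i) = X j" "act (s i) (X j) = X i" "act (s i) (X (Suc j)) = X (Suc j)"
  "act (s j) (X i) = X i" "act (s j) (X j) = X (Suc j)" "act (s j) (X (Suc j)) = X j"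
  by (simp_all add: act_X s_apply j)

lemma act_braid: "act (s j) (act (s i) (act (s j) P)) = act (s i) (act (s j) (act (s i) P))"
proof -
  have "s j \<circ> (s i \<circ> s j) = s i \<circ> (s j \<circ> s i)"
    by (auto simp: fun_eq_iff s_apply j)
  then have "act (s j \<circ> (s i \<circ> s j)) P = act (s i \<circ> (s j \<circ> s i)) P" by simp
  then show ?thesis by (simp add: act_comp bij_comp)
qed

lemma act_act_dd: "act (s j) (act (s i) (dd j P)) = dd i (act (s j) (act (s i) P))"
    "act (s i) (act (s j) (dd i P)) = dd j (act (s i) (act (s j) P))"
proof -
  have "act (s j \<circ> s i) (dd j P) = dd i (act (s j \<circ> s i) P)"
    by (rule act_dd) (auto simp: bij_comp s_apply j)
  then show "act (s j) (act (s i) (dd j P)) = dd i (act (s j) (act (s i) P))"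
    by (simp add: act_comp)
  have "act (s i \<circ> s j) (dd i P) = dd j (act (s i \<circ> s j) P)"
    by (rule act_dd) (auto simp: bij_comp s_apply j)
  then show "act (s i) (act (s j) (dd i P)) = dd j (act (s i) (act (s j) P))"
    by (simp add: act_comp)
qed

lemma dd_i: "(X i - X j) * dd i P = P - act (s i) P"
  using dd_eq[of i P] by (simp add: j)

lemma dd_j: "(X j - X (Suc j)) * dd j P = P - act (s j) P"
  by (rule dd_eq)

lemma braid_nonzero: "(X i - X j) * (X i - X (Suc j)) * (X j - X (Suc j)) \<noteq> 0"
  by (simp add: j)

lemmas actI = arg_cong[where f = "act (s i)"] and actJ = arg_cong[where f = "act (s j)"]
lemmas act_ring = act_mult[OF bij_s] act_diff[OF bij_s] act_X_braid act_s_s act_braid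

lemma act_s_dd: "act (s k) (dd k P) = dd k P"
  using dd_eq[of k "dd k P"] by simp

lemma cancel_three:
  fixes a b c x y z p q r t :: mpoly_int
  assumes "a * x = y - z" "b * y = p - q" "c * z = r - t"
  shows "a * c * b * x = c * (p - q) - b * (r - t)"
proof -
  have "a * c * b * x = c * b * (a * x)" by (simp add: mult_ac)
  also have "\<dots> = c * b * (y - z)" by (simp only: assms(1))
  also have "\<dots> = c * (b * y) - b * (c * z)" by (simp add: right_diff_distrib mult_ac)
  finally show ?thesis by (simp only: assms)
qed

private abbreviation (input) "S \<equiv> act (s i)"
private abbreviation (input) "T \<equiv> act (s j)"
private abbreviation (input) "D \<equiv> dd i"
private abbreviation (input) "E \<equiv> dd j"
private abbreviation (input) "a \<equiv> X i - X j"
private abbreviation (input) "b \<equiv> X j - X (Suc j)"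
private abbreviation (input) "c \<equiv> X i - X (Suc j)"

lemma dd_rules:
  "a * D P = P - S P"
  "c * T (D P) = T P - T (S P)"
  "b * S (T (D P)) = S (T P) - S (T (S P))"
  "b * E P = P - T P"
  "c * S (E P) = S P - S (T P)"
  "a * T (S (E P)) = T (S P) - S (T (S P))"
proof -
  show D: "a * D P = P - S P" and E: "b * E P = P - T P"
    by (simp_all add: dd_i dd_j)
  show TD: "c * T (D P) = T P - T (S P)" using actJ[OF D] by (simp add: act_ring)
  show "b * S (T (D P)) = S (T P) - S (T (S P))" using actI[OF TD] by (simp add: act_ring)
  show SE: "c * S (E P) = S P - S (T P)" using actI[OF E] by (simp add: act_ring)
  show "a * T (S (E P)) = T (S P) - S (T (S P))" using actJ[OF SE] by (simp add: act_ring)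
qed

lemma dd_braid: "D (E (D P)) = E (D (E P))"
proof -
  have "a * c * b * D (E (D P)) = c * (D P - T (D P)) - b * (D P - S (T (D P)))"
    using cancel_three[OF dd_rules(1,4,5)] by (simp add: act_s_dd)
  also have "\<dots> = a * D P - c * T (D P) + b * S (T (D P))"
    by (simp add: algebra_simps)
  also have "\<dots> = (P - S P) - (T P - T (S P)) + (S (T P) - S (T (S P)))"
    by (simp only: dd_rules)
  finally have 1: "a * c * b * D (E (D P)) = \<dots>" .
  have "b * c * a * E (D (E P)) = c * (E P - S (E P)) - a * (E P - T (S (E P)))"
    using cancel_three[OF dd_rules(4,1,2)] by (simp add: act_s_dd)
  also have "\<dots> = b * E P - c * S (E P) + a * T (S (E P))"
    by (simp add: algebra_simps)
  also have "\<dots> = (P - T P) - (S P - S (T P)) + (T (S P) - S (T (S P)))"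
    by (simp only: dd_rules)
  finally have "a * c * b * D (E (D P)) = a * c * b * E (D (E P))"
    unfolding 1 by (simp add: mult_ac)
  then show ?thesis using braid_nonzero by simp
qed

lemma dd_act_braid_1: "D (E (S P)) + S (E (D P)) = E (S (E P))"
proof -
  have 1: "a * c * b * D (E (S P)) = c * (S P - T (S P)) - b * (P - S (T (S P)))"
    using cancel_three[OF dd_rules(1)[of "E (S P)"] dd_rules(4)[of "S P"] dd_rules(5)[of "S P"]]
    by simp
  have "a * c * b * S (E (D P)) = a * b * (c * S (E (D P)))"
    by (simp only: mult_ac)
  also have "\<dots> = a * b * (D P - S (T (D P)))"
    by (simp only: dd_rules(5) act_s_dd)
  also have "\<dots> = b * (a * D P) - a * (b * S (T (D P)))"
    by (simp add: algebra_simps)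
  also have "\<dots> = b * (P - S P) - a * (S (T P) - S (T (S P)))"
    by (simp only: dd_rules)
  finally have 2: "a * c * b * S (E (D P)) = \<dots>" .
  have 3: "b * a * c * E (S (E P)) = a * (S P - S (T P)) - c * (T (S P) - S (T (S P)))"
    by (rule cancel_three[OF dd_rules(4)[of "S (E P)"] dd_rules(5)[of P] dd_rules(6)[of P]])
  have "a * c * b * (D (E (S P)) + S (E (D P))) = b * a * c * E (S (E P))"
    unfolding distrib_left 1 2 3 by (simp add: algebra_simps)
  then have "a * c * b * (D (E (S P)) + S (E (D P))) = a * c * b * E (S (E P))"
    by (simp only: mult_ac)
  then show ?thesis using braid_nonzero by simp
qed

lemma dd_act_braid_2: "E (D (T P)) + T (D (E P)) = D (T (D P))"
proof -
  have 1: "b * c * a * E (D (T P)) = c * (T P - S (T P)) - a * (P - S (T (S P)))"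
    using cancel_three[OF dd_rules(4)[of "D (T P)"] dd_rules(1)[of "T P"] dd_rules(2)[of "T P"]]
    by (simp add: act_braid)
  have "b * c * a * T (D (E P)) = a * b * (c * T (D (E P)))"
    by (simp only: mult_ac)
  also have "\<dots> = a * b * (E P - T (S (E P)))"
    by (simp only: dd_rules(2) act_s_dd)
  also have "\<dots> = a * (b * E P) - b * (a * T (S (E P)))"
    by (simp add: algebra_simps)
  also have "\<dots> = a * (P - T P) - b * (T (S P) - S (T (S P)))"
    by (simp only: dd_rules)
  finally have 2: "b * c * a * T (D (E P)) = \<dots>" .
  have 3: "a * b * c * D (T (D P)) = b * (T P - T (S P)) - c * (S (T P) - S (T (S P)))"
    by (rule cancel_three[OF dd_rules(1)[of "T (D P)"] dd_rules(2)[of P] dd_rules(3)[of P]])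
  have "b * c * a * (E (D (T P)) + T (D (E P))) = a * b * c * D (T (D P))"
    unfolding distrib_left 1 2 3 by (simp add: algebra_simps)
  then have "a * c * b * (E (D (T P)) + T (D (E P))) = a * c * b * D (T (D P))"
    by (simp only: mult_ac)
  then show ?thesis using braid_nonzero by simp
qed

end

section \<open>Skew divided difference operators\<close>

text \<open>\<open>skew_family F\<close> says that the operators \<open>F u w = \<partial>\<^sub>u\<^sup>w\<close> (\<open>u, w \<in> S_inf\<close>) satisfy the
  recurrence. Such a family exists and is unique on \<open>S_inf\<close> (\<open>skew_family_skew_dd\<close>,
  \<open>skew_family_unique\<close>), and it satisfies the generalized Leibniz formula (\<open>leibniz\<close>),
  where \<open>\<partial>\<^sup>w = skew_dd id w\<close> (\<open>skew_dd_reduced_word\<close>).\<close>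

definition skew_family :: "((nat \<Rightarrow> nat) \<Rightarrow> (nat \<Rightarrow> nat) \<Rightarrow> mpoly_int \<Rightarrow> mpoly_int) \<Rightarrow> bool" where
  "skew_family F \<longleftrightarrow>
     F id id = id \<and>
     (\<forall>u\<in>S_inf. u \<noteq> id \<longrightarrow> F u id = (\<lambda>P. 0)) \<and>
     (\<forall>u\<in>S_inf. \<forall>w\<in>S_inf. \<forall>i\<ge>1. len (w \<circ> s i) < len w \<longrightarrow>
        (len (u \<circ> s i) < len u \<longrightarrow>
           F u w = (\<lambda>P. F u (w \<circ> s i) (dd i P) + F (u \<circ> s i) (w \<circ> s i) (act (s i) P))) \<and>
        (len (u \<circ> s i) > len u \<longrightarrow>
           F u w = (\<lambda>P. F u (w \<circ> s i) (dd i P))))"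

definition skew_dd :: "(nat \<Rightarrow> nat) \<Rightarrow> (nat \<Rightarrow> nat) \<Rightarrow> mpoly_int \<Rightarrow> mpoly_int" where
  "skew_dd = (SOME F. skew_family F)"

text \<open>The Schubert polynomial of the longest element of the symmetric group on \<open>{1..n + 1}\<close>.\<close>

definition schubert_w0 :: "nat \<Rightarrow> mpoly_int" where
  "schubert_w0 n = (\<Prod>i=1..n. X i ^ (n + 1 - i))"

definition skew_schubert :: "(nat \<Rightarrow> nat) \<Rightarrow> (nat \<Rightarrow> nat) \<Rightarrow> nat \<Rightarrow> mpoly_int" where
  "skew_schubert u w n = act (inv u) (skew_dd u w (schubert_w0 n))"

subsection \<open>Existence, uniqueness and the Leibniz formula\<close>

text \<open>One step of the recurrence, on all \<open>u\<close> simultaneously; these steps satisfy the braid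
  relations, so that composing them along a reduced word of \<open>w\<close> depends on \<open>w\<close> only.\<close>

definition skew_step ::
    "nat \<Rightarrow> ((nat \<Rightarrow> nat) \<Rightarrow> mpoly_int \<Rightarrow> mpoly_int) \<Rightarrow> (nat \<Rightarrow> nat) \<Rightarrow> mpoly_int \<Rightarrow> mpoly_int" where
  "skew_step i m u P =
     (if u \<in> S_inf
      then m u (dd i P) + (if u (Suc i) < u i then m (u \<circ> s i) (act (s i) P) else 0)
      else 0)"

definition add_family :: "((nat \<Rightarrow> nat) \<Rightarrow> mpoly_int \<Rightarrow> mpoly_int) \<Rightarrow> bool" where
  "add_family m \<longleftrightarrow> (\<forall>u P Q. m u (P + Q) = m u P + m u Q)"

lemma add_family_step: "add_family m \<Longrightarrow> add_family (skew_step i m)"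
  by (simp add: add_family_def skew_step_def dd_add act_add)

lemma comp_s_in_S_inf [simp]:
  assumes "1 \<le> i"
  shows "u \<circ> s i \<in> S_inf \<longleftrightarrow> u \<in> S_inf"
  using S_inf_comp[OF _ s_in_S_inf[OF assms]] comp_s_s by metis

lemma comp_s_far:
  assumes "Suc i < j \<or> Suc j < i"
  shows "(u \<circ> s i) \<circ> s j = (u \<circ> s j) \<circ> s i"
  using assms by (auto simp: fun_eq_iff s_apply)

lemma skew_step_far:
  assumes "1 \<le> i" "1 \<le> j" and far: "Suc i < j \<or> Suc j < i" and m: "add_family m"
  shows "skew_step i (skew_step j m) = skew_step j (skew_step i m)"
proof (intro ext)
  fix u :: "nat \<Rightarrow> nat" and P
  have "(u \<circ> s i) j = u j" "(u \<circ> s i) (Suc j) = u (Suc j)"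
    "(u \<circ> s j) i = u i" "(u \<circ> s j) (Suc i) = u (Suc i)"
    using far by (auto simp: s_apply)
  then show "skew_step i (skew_step j m) u P = skew_step j (skew_step i m) u P"
    using assms act_far[OF far] act_dd_far[OF far] dd_far[OF far]
      act_dd_far[of j i] comp_s_far[OF far, of u]
    by (auto simp: skew_step_def add_ac)
qed

lemma skew_step_braid:
  assumes "1 \<le> i" and j: "j = Suc i" and m: "add_family m"
  shows "skew_step i (skew_step j (skew_step i m)) = skew_step j (skew_step i (skew_step j m))"
proof (intro ext)
  fix u P
  show "skew_step i (skew_step j (skew_step i m)) u P
      = skew_step j (skew_step i (skew_step j m)) u P"
  proof (cases "u \<in> S_inf")
    case False
    then show ?thesis by (simp add: skew_step_def)
  next
    case True
    have add: "m v A + m v B = m v (A + B)" for v A B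
      using m by (simp add: add_family_def)
    have j1: "1 \<le> j" using j by simp
    have val: "s i i = j" "s i j = i" "s i (Suc j) = Suc j" "s j i = i" "s j j = Suc j" "s j (Suc j) = j"
      by (simp_all add: s_apply j)
    have cc: "((v \<circ> s i) \<circ> s j) \<circ> s i = ((v \<circ> s j) \<circ> s i) \<circ> s j" for v :: "nat \<Rightarrow> nat"
      by (auto simp: fun_eq_iff s_apply j)
    have i: "m v (dd i (dd j (act (s i) P))) + m v (act (s i) (dd j (dd i P)))
        = m v (dd j (act (s i) (dd j P)))" for v
      by (simp add: add dd_act_braid_1[OF j])
    have i': "m v (act (s i) (dd j (dd i P))) + m v (dd i (dd j (act (s i) P)))
        = m v (dd j (act (s i) (dd j P)))" for v
      using i[of v] by (simp only: add.commute)
    have k: "m v (dd j (dd i (act (s j) P))) + m v (act (s j) (dd i (dd j P)))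
        = m v (dd i (act (s j) (dd i P)))" for v
      by (simp add: add dd_act_braid_2[OF j])
    have step: "skew_step k m v Q =
       m v (dd k Q) + (if v (Suc k) < v k then m (v \<circ> s k) (act (s k) Q) else 0)"
       if "v \<in> S_inf" for k m v Q
      using that by (simp add: skew_step_def)
    have ne: "u i \<noteq> u j" "u j \<noteq> u (Suc j)" "u i \<noteq> u (Suc j)"
      using S_inf_inj[OF True] j by (auto dest!: injD)
    have S: "u \<circ> s i \<in> S_inf" "u \<circ> s j \<in> S_inf" "u \<circ> s i \<circ> s j \<in> S_inf" "u \<circ> s j \<circ> s i \<in> S_inf"
      using True assms(1) j1 by simp_all
    show ?thesis
      unfolding step[OF True] step[OF S(1)] step[OF S(2)] step[OF S(3)] step[OF S(4)]
        j[symmetric]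
      using ne i[of "u \<circ> s i"] k[of "u \<circ> s j"] cc[of u] act_braid[OF j, of P]
        act_act_dd[OF j, of P] dd_braid[OF j, of P]
      by (cases "u j < u i"; cases "u (Suc j) < u j"; cases "u (Suc j) < u i")
        (simp_all add: val add_ac)
  qed
qed

inductive skew_rel ::
    "(nat \<Rightarrow> nat) \<Rightarrow> ((nat \<Rightarrow> nat) \<Rightarrow> mpoly_int \<Rightarrow> mpoly_int) \<Rightarrow> bool" where
  base: "skew_rel id (\<lambda>u. if u = id then id else (\<lambda>P. 0))"
| step: "w \<in> S_inf \<Longrightarrow> 1 \<le> i \<Longrightarrow> w (Suc i) < w i \<Longrightarrow> skew_rel (w \<circ> s i) m
    \<Longrightarrow> skew_rel w (skew_step i m)"

lemma skew_rel_add: "skew_rel w m \<Longrightarrow> add_family m"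
proof (induction rule: skew_rel.induct)
  case base
  then show ?case by (simp add: add_family_def)
next
  case step
  then show ?case by (simp add: add_family_step)
qed

lemma descent_induct [consumes 1, case_names id descent]:
  assumes "w \<in> S_inf" "R id"
    and "\<And>w i. w \<in> S_inf \<Longrightarrow> 1 \<le> i \<Longrightarrow> w (Suc i) < w i \<Longrightarrow> R (w \<circ> s i) \<Longrightarrow> R w"
  shows "R w"
  using assms(1)
proof (induction "len w" arbitrary: w rule: less_induct)
  case less
  show ?case
  proof (cases "w = id")
    case False
    then obtain i where "1 \<le> i" "w (Suc i) < w i"
      using ex_descent less.prems by blast
    moreover then have "R (w \<circ> s i)"
      using less by (simp add: len_s_less_iff)
    ultimately show ?thesis using assms(3) less.prems by blast
  qed (use assms(2) in simp)
qed

lemma skew_rel_ex: "w \<in> S_inf \<Longrightarrow> \<exists>m. skew_rel w m"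
  by (induction w rule: descent_induct) (blast intro: skew_rel.intros)+

lemma skew_rel_unique:
  assumes "w \<in> S_inf" "skew_rel w m" "skew_rel w m'"
  shows "m = m'"
  using assms
proof (induction "len w" arbitrary: w m m' rule: less_induct)
  case less
  note w = \<open>w \<in> S_inf\<close>
  have IH: "n = n'" if "1 \<le> i" "w (Suc i) < w i" "skew_rel (w \<circ> s i) n" "skew_rel (w \<circ> s i) n'" for i n n'
    using less.hyps[of "w \<circ> s i" n n'] that w by (simp add: len_s_less_iff)
  have braid: "skew_step i n = skew_step j n'"
    if "1 \<le> i" "j = Suc i" "w (Suc i) < w i" "w (Suc j) < w j"
      "skew_rel (w \<circ> s i) n" "skew_rel (w \<circ> s j) n'" for i j n n'
  proof -
    have j: "1 \<le> j" using that by simp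
    have "w \<circ> s i \<circ> s j \<circ> s i \<in> S_inf" using w that(1) j by simp
    then obtain k where k: "skew_rel (w \<circ> s i \<circ> s j \<circ> s i) k"
      using skew_rel_ex by blast
    have eq: "w \<circ> s i \<circ> s j \<circ> s i = w \<circ> s j \<circ> s i \<circ> s j"
      by (auto simp: fun_eq_iff s_apply that(2))
    have "skew_rel (w \<circ> s i) (skew_step j (skew_step i k))"
      using k that w j by (intro skew_rel.step) (simp_all add: s_apply)
    then have n: "n = skew_step j (skew_step i k)" using IH that by blast
    have "skew_rel (w \<circ> s j) (skew_step i (skew_step j k))"
      using k[unfolded eq] that w j by (intro skew_rel.step) (simp_all add: s_apply)
    then have n': "n' = skew_step i (skew_step j k)" using IH that j by blast
    show ?thesis
      unfolding n n' using skew_step_braid that skew_rel_add[OF k] by blast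
  qed
  show ?case
  proof (cases "w = id")
    case True
    have "n = (\<lambda>u. if u = id then id else (\<lambda>P. 0))" if "skew_rel w n" for n
      using that
    proof (cases rule: skew_rel.cases)
      case (step i k)
      then show ?thesis using True by simp
    qed simp
    from this[OF less.prems(2)] this[OF less.prems(3)] show ?thesis
      by (rule trans[OF _ sym])
  next
    case False
    obtain i n where i: "m = skew_step i n" "1 \<le> i" "w (Suc i) < w i" "skew_rel (w \<circ> s i) n"
      using less.prems(2) False by (cases rule: skew_rel.cases) auto
    obtain j n' where j: "m' = skew_step j n'" "1 \<le> j" "w (Suc j) < w j" "skew_rel (w \<circ> s j) n'"
      using less.prems(3) False by (cases rule: skew_rel.cases) auto
    consider "i = j" | "Suc i < j \<or> Suc j < i" | "j = Suc i" | "i = Suc j"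
      by linarith
    then show ?thesis
    proof cases
      case 1
      then show ?thesis using i j IH by blast
    next
      case 2
      have "w \<circ> s i \<circ> s j \<in> S_inf" using w i j by simp
      then obtain k where k: "skew_rel (w \<circ> s i \<circ> s j) k"
        using skew_rel_ex by blast
      have "s i j = j" "s i (Suc j) = Suc j" "s j i = i" "s j (Suc i) = Suc i"
        using 2 by (auto simp: s_apply)
      then have "skew_rel (w \<circ> s i) (skew_step j k)" "skew_rel (w \<circ> s j) (skew_step i k)"
        using k i j w comp_s_far[OF 2, of w] by (auto intro!: skew_rel.step)
      then have "n = skew_step j k" "n' = skew_step i k"
        using IH i j by blast+
      then show ?thesis
        using i j skew_step_far[OF i(2) j(2) 2 skew_rel_add[OF k]] by simp
    next
      case 3
      then show ?thesis using braid i j by blast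
    next
      case 4
      then show ?thesis using braid i j by metis
    qed
  qed
qed

lemma skew_family_step:
  assumes "skew_family F" "u \<in> S_inf" "w \<in> S_inf" "1 \<le> i" "w (Suc i) < w i"
  shows "F u w P = F u (w \<circ> s i) (dd i P) +
    (if u (Suc i) < u i then F (u \<circ> s i) (w \<circ> s i) (act (s i) P) else 0)"
proof -
  have "len (w \<circ> s i) < len w" using assms by (simp add: len_s_less_iff)
  then have "len (u \<circ> s i) < len u \<Longrightarrow>
      F u w = (\<lambda>P. F u (w \<circ> s i) (dd i P) + F (u \<circ> s i) (w \<circ> s i) (act (s i) P))"
    and "len (u \<circ> s i) > len u \<Longrightarrow> F u w = (\<lambda>P. F u (w \<circ> s i) (dd i P))"
    using assms unfolding skew_family_def by blast+
  then show ?thesis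
    using assms S_inf_neq[of u i]
    by (auto simp: len_s_less_iff len_s_greater_iff linorder_neq_iff)
qed

lemma skew_family_ex: "\<exists>F. skew_family F"
proof
  let ?F = "\<lambda>u w. (THE m. skew_rel w m) u"
  have F: "?F u w = m u" if "w \<in> S_inf" "skew_rel w m" for u w m
    using skew_rel_unique[OF that(1)] that(2) by (simp add: the_equality)
  have step: "?F u w P = skew_step i (\<lambda>v. ?F v (w \<circ> s i)) u P"
    if w: "w \<in> S_inf" "1 \<le> i" "w (Suc i) < w i" for u w i P
  proof -
    obtain m where m: "skew_rel (w \<circ> s i) m"
      using skew_rel_ex[of "w \<circ> s i"] comp_s_in_S_inf[of i w] w by blast
    have "(\<lambda>v. ?F v (w \<circ> s i)) = m" using F[OF _ m] w by (simp del: o_apply)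
    then show ?thesis using F[OF w(1) skew_rel.step[OF w m]] by simp
  qed
  show "skew_family ?F"
    unfolding skew_family_def
  proof (intro conjI ballI allI impI)
    show "?F id id = id" using F[OF id_in_S_inf skew_rel.base] by simp
    show "?F u id = (\<lambda>P. 0)" if "u \<noteq> id" for u
      using F[OF id_in_S_inf skew_rel.base] that by simp
  next
    fix u w i assume *: "u \<in> S_inf" "w \<in> S_inf" "1 \<le> (i :: nat)" "len (w \<circ> s i) < len w"
    then have d: "w (Suc i) < w i" by (simp add: len_s_less_iff)
    {
      assume "len (u \<circ> s i) < len u"
      then have "u (Suc i) < u i" using * by (simp add: len_s_less_iff)
      then show "?F u w = (\<lambda>P. ?F u (w \<circ> s i) (dd i P) + ?F (u \<circ> s i) (w \<circ> s i) (act (s i) P))"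
        using step[OF *(2,3) d] *(1) by (simp add: fun_eq_iff skew_step_def)
    next
      assume "len u < len (u \<circ> s i)"
      then have "u i < u (Suc i)" using * by (simp add: len_s_greater_iff)
      then show "?F u w = (\<lambda>P. ?F u (w \<circ> s i) (dd i P))"
        using step[OF *(2,3) d] *(1) by (simp add: fun_eq_iff skew_step_def)
    }
  qed
qed

lemma skew_family_unique:
  assumes "w \<in> S_inf" "u \<in> S_inf" "skew_family F" "skew_family G"
  shows "F u w = G u w"
  using assms(1,2)
proof (induction w arbitrary: u rule: descent_induct)
  case id
  then show ?case using assms(3,4) unfolding skew_family_def by metis
next
  case (descent w i)
  have "u \<circ> s i \<in> S_inf" using descent by simp
  then show ?case
    using descent
    by (intro ext) (simp add: skew_family_step[OF assms(3)] skew_family_step[OF assms(4)] del: o_apply)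
qed

lemma skew_family_skew_dd: "skew_family skew_dd"
  unfolding skew_dd_def using skew_family_ex by (rule someI_ex)

lemma skew_dd_id: "skew_dd id id = id"
  and skew_dd_not_id: "u \<in> S_inf \<Longrightarrow> u \<noteq> id \<Longrightarrow> skew_dd u id = (\<lambda>P. 0)"
  using skew_family_skew_dd unfolding skew_family_def by blast+

lemmas skew_dd_step = skew_family_step[OF skew_family_skew_dd]

lemma skew_dd_add:
  assumes "w \<in> S_inf" "u \<in> S_inf"
  shows "skew_dd u w (P + Q) = skew_dd u w P + skew_dd u w Q"
  using assms
proof (induction w arbitrary: u P Q rule: descent_induct)
  case id
  have "id P = P" for P :: mpoly_int by simp
  with id show ?case by (cases "u = id") (simp_all add: skew_dd_id skew_dd_not_id del: id_apply)
next
  case (descent w i)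
  have "u \<circ> s i \<in> S_inf" using descent by simp
  then show ?case
    using descent by (simp add: skew_dd_step dd_add act_add del: o_apply)
qed

lemma skew_dd_0: "w \<in> S_inf \<Longrightarrow> u \<in> S_inf \<Longrightarrow> skew_dd u w 0 = 0"
  using skew_dd_add[of w u 0 0] by simp

lemma skew_dd_Zx:
  assumes "w \<in> S_inf" "u \<in> S_inf" "P \<in> Zx"
  shows "skew_dd u w P \<in> Zx"
  using assms
proof (induction w arbitrary: u P rule: descent_induct)
  case id
  have "id P = P" for P :: mpoly_int by simp
  with id show ?case by (cases "u = id") (simp_all add: skew_dd_id skew_dd_not_id del: id_apply)
next
  case (descent w i)
  have "u \<circ> s i \<in> S_inf" using descent by simp
  then show ?case
    using descent by (simp add: skew_dd_step dd_in_Zx Zx_act Zx_add del: o_apply)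
qed

definition word_perm :: "nat list \<Rightarrow> nat \<Rightarrow> nat" where
  "word_perm is = foldr (\<lambda>i v. s i \<circ> v) is id"

definition dd_word :: "nat list \<Rightarrow> mpoly_int \<Rightarrow> mpoly_int" where
  "dd_word is = foldr (\<lambda>i v. dd i \<circ> v) is id"

lemma word_perm_snoc: "word_perm (is @ [i]) = word_perm is \<circ> s i"
  by (induction "is") (simp_all add: word_perm_def comp_assoc)

lemma dd_word_snoc: "dd_word (is @ [i]) = dd_word is \<circ> dd i"
  by (induction "is") (simp_all add: dd_word_def comp_assoc)

lemma word_perm_in_S_inf: "(\<forall>i\<in>set is. 1 \<le> i) \<Longrightarrow> word_perm is \<in> S_inf"
  by (induction "is") (auto simp: word_perm_def intro: S_inf_comp s_in_S_inf)

lemma len_id [simp]: "len id = 0"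
proof -
  have "{(i, j). 1 \<le> i \<and> i < j \<and> id i > (id j :: nat)} = {}" by auto
  then show ?thesis by (simp only: len_def card.empty)
qed

lemma len_word_perm: "(\<forall>i\<in>set is. 1 \<le> i) \<Longrightarrow> len (word_perm is) \<le> length is"
proof (induction "is" rule: rev_induct)
  case Nil
  have "word_perm [] = id" by (simp add: word_perm_def)
  then show ?case by (simp del: id_apply)
next
  case (snoc i js)
  then have "word_perm js \<in> S_inf" "1 \<le> i" by (simp_all add: word_perm_in_S_inf)
  then have "len (word_perm js \<circ> s i) \<le> Suc (len (word_perm js))"
    using len_s_ascent[of "word_perm js" i] len_s_descent[of "word_perm js" i]
      S_inf_neq[of "word_perm js" i] by linarith
  then show ?case using snoc by (simp add: word_perm_snoc del: o_apply)
qed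

lemma skew_dd_reduced_word:
  assumes "\<forall>i\<in>set is. 1 \<le> i" "len (word_perm is) = length is"
  shows "dd_word is = skew_dd id (word_perm is)"
  using assms
proof (induction "is" rule: rev_induct)
  case Nil
  have "word_perm [] = id" "dd_word [] = id" by (simp_all add: word_perm_def dd_word_def)
  then show ?case by (simp add: skew_dd_id del: id_apply)
next
  case (snoc i js)
  let ?v = "word_perm js"
  have v: "?v \<in> S_inf" "1 \<le> i" "len ?v \<le> length js"
    using snoc.prems by (simp_all add: word_perm_in_S_inf len_word_perm)
  have l: "len (?v \<circ> s i) = Suc (length js)"
    using snoc.prems by (simp add: word_perm_snoc del: o_apply)
  then have asc: "?v i < ?v (Suc i)"
    using len_s_greater_iff[OF v(1,2)] v(3) by simp
  then have "len ?v = length js"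
    using len_s_ascent[OF v(1,2)] l by simp
  then have "dd_word js = skew_dd id ?v"
    using snoc by (simp del: id_apply)
  then have "dd_word (js @ [i]) = skew_dd id ?v \<circ> dd i"
    unfolding dd_word_snoc by (rule arg_cong)
  also have "\<dots> = skew_dd id (?v \<circ> s i)"
  proof
    fix P
    show "(skew_dd id ?v \<circ> dd i) P = skew_dd id (?v \<circ> s i) P"
      using skew_dd_step[of id "?v \<circ> s i" i P] v asc by (simp add: s_apply)
  qed
  finally show ?case unfolding word_perm_snoc .
qed

lemma leibniz:
  assumes "w \<in> S_inf"
  shows "finite {u \<in> S_inf. skew_dd u w \<noteq> (\<lambda>P. 0)}"
    and "skew_dd id w (P * Q) =
      (\<Sum>u | u \<in> S_inf \<and> skew_dd u w \<noteq> (\<lambda>P. 0). skew_dd id u P * skew_dd u w Q)"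
proof -
  have "\<exists>A. finite A \<and> A \<subseteq> S_inf \<and> (\<forall>u\<in>S_inf - A. skew_dd u w = (\<lambda>P. 0)) \<and>
      (\<forall>P Q. skew_dd id w (P * Q) = (\<Sum>u\<in>A. skew_dd id u P * skew_dd u w Q))"
    using assms
  proof (induction w rule: descent_induct)
    case id
    have "id P = P" for P :: mpoly_int by simp
    then show ?case
      by (intro exI[of _ "{id}"]) (simp add: skew_dd_id skew_dd_not_id del: id_apply)
  next
    case (descent w i)
    then obtain B where B: "finite B" "B \<subseteq> S_inf"
      "\<And>u. u \<in> S_inf \<Longrightarrow> u \<notin> B \<Longrightarrow> skew_dd u (w \<circ> s i) = (\<lambda>P. 0)"
      "\<And>P Q. skew_dd id (w \<circ> s i) (P * Q) = (\<Sum>u\<in>B. skew_dd id u P * skew_dd u (w \<circ> s i) Q)"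
      by blast
    let ?v = "w \<circ> s i" and ?r = "\<lambda>u :: nat \<Rightarrow> nat. u \<circ> s i"
    define A where "A = B \<union> ?r ` B"
    have v: "?v \<in> S_inf" using descent by simp
    have A: "finite A" "A \<subseteq> S_inf" using B descent by (auto simp: A_def)
    have rA: "?r u \<in> A" if "u \<in> A" for u
      using that comp_s_s[of _ i] unfolding A_def by (auto simp del: o_apply)
    have BA: "skew_dd id ?v (P * Q) = (\<Sum>u\<in>A. skew_dd id u P * skew_dd u ?v Q)" for P Q
      unfolding B(4) by (rule sum.mono_neutral_left) (use A B(3) in \<open>auto simp: A_def\<close>)
    have out: "skew_dd u w = (\<lambda>P. 0)" if "u \<in> S_inf - A" for u
    proof -
      have "u \<notin> B" "?r u \<notin> B"
        using that comp_s_s[of u i] unfolding A_def by (blast, metis DiffE UnI2 imageI)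
      then show ?thesis
        using that descent B(3) by (intro ext) (simp add: skew_dd_step del: o_apply)
    qed
    have formula: "skew_dd id w (P * Q) = (\<Sum>u\<in>A. skew_dd id u P * skew_dd u w Q)" for P Q
    proof -
      have sh: "skew_dd id (?r u) (dd i P) = (if u (Suc i) < u i then skew_dd id u P else 0)"
        if u: "u \<in> S_inf" for u
      proof (cases "u (Suc i) < u i")
        case True
        then show ?thesis using skew_dd_step[of id u i P] u descent by (simp del: o_apply)
      next
        case False
        then have "?r u (Suc i) < ?r u i"
          using S_inf_neq[OF u, of i] by (simp add: s_apply)
        then have "skew_dd id (?r u) (dd i P) = skew_dd id u (dd i (dd i P))"
          using skew_dd_step[of id "?r u" i "dd i P"] u descent by (simp del: o_apply)
        then show ?thesis using False u by (simp add: skew_dd_0)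
      qed
      have "skew_dd id w (P * Q) = skew_dd id ?v (P * dd i Q + dd i P * act (s i) Q)"
        using skew_dd_step[of id w i "P * Q"] descent by (simp add: dd_mult)
      also have "\<dots> = (\<Sum>u\<in>A. skew_dd id u P * skew_dd u ?v (dd i Q)) +
          (\<Sum>u\<in>A. skew_dd id u (dd i P) * skew_dd u ?v (act (s i) Q))"
        using v by (simp add: skew_dd_add BA)
      also have "(\<Sum>u\<in>A. skew_dd id u (dd i P) * skew_dd u ?v (act (s i) Q)) =
          (\<Sum>u\<in>A. skew_dd id (?r u) (dd i P) * skew_dd (?r u) ?v (act (s i) Q))"
        by (rule sum.reindex_bij_witness[where i = ?r and j = ?r]) (use rA in \<open>auto simp del: o_apply\<close>)
      also have "(\<Sum>u\<in>A. skew_dd id u P * skew_dd u ?v (dd i Q)) + \<dots> =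
          (\<Sum>u\<in>A. skew_dd id u P * skew_dd u w Q)"
        unfolding sum.distrib[symmetric]
      proof (rule sum.cong[OF refl])
        fix u assume "u \<in> A"
        then have u: "u \<in> S_inf" using A by blast
        show "skew_dd id u P * skew_dd u ?v (dd i Q) +
            skew_dd id (?r u) (dd i P) * skew_dd (?r u) ?v (act (s i) Q) =
            skew_dd id u P * skew_dd u w Q"
          unfolding sh[OF u] skew_dd_step[OF u descent.hyps]
          by (simp add: distrib_left del: o_apply)
      qed
      finally show ?thesis .
    qed
    show ?case using A out formula by blast
  qed
  then obtain A where A: "finite A" "A \<subseteq> S_inf" "\<forall>u\<in>S_inf - A. skew_dd u w = (\<lambda>P. 0)"
    "\<And>P Q. skew_dd id w (P * Q) = (\<Sum>u\<in>A. skew_dd id u P * skew_dd u w Q)"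
    by blast
  have sub: "{u \<in> S_inf. skew_dd u w \<noteq> (\<lambda>P. 0)} \<subseteq> A" using A(3) by blast
  then show "finite {u \<in> S_inf. skew_dd u w \<noteq> (\<lambda>P. 0)}" using A(1) finite_subset by blast
  show "skew_dd id w (P * Q) =
      (\<Sum>u | u \<in> S_inf \<and> skew_dd u w \<noteq> (\<lambda>P. 0). skew_dd id u P * skew_dd u w Q)"
    unfolding A(4) by (rule sum.mono_neutral_right) (use A sub in auto)
qed

end

theory Submission
  imports Defs
begin

text \<open>The operators satisfy \<open>\<partial>\<^sub>u\<^sup>w(PQ) = \<Sum>\<^sub>t \<partial>\<^sub>u\<^sup>t(P) \<partial>\<^sub>t\<^sup>w(Q)\<close>, and the Schubert polynomial of
  \<open>w\<^sub>0(n)\<close> is the product of the monomials \<open>x\<^sub>1\<cdots>x\<^sub>k\<close> for \<open>k \<le> n\<close>, so it suffices to treat such a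
  monomial. A descent \<open>i \<noteq> k\<close> of \<open>w\<close> can be removed, because \<open>x\<^sub>1\<cdots>x\<^sub>k\<close> is symmetric in \<open>x\<^sub>i\<close> and
  \<open>x\<^bsub>i+1\<^esub>\<close>. Otherwise \<open>w\<close> is increasing on \<open>1, \<dots>, k\<close>. The recurrence then only meets
  square-free monomials such that \<open>x\<^bsub>i+1\<^esub>\<close> does not occur whenever \<open>i\<close> is the descent being used,
  so that the divided differences of the monomials never have a negative sign.\<close>

section \<open>The Leibniz rule for skew divided differences\<close>

lemma act_s_dd_same: "act (s i) (dd i P) = dd i P"
  using dd_eq[of i "dd i P"] by simp

lemma dd_act_same: "dd i (act (s i) P) = - dd i P"
  by (rule dd_unique) (simp add: dd_eq)

lemma skew_dd_uminus:
  assumes "w \<in> S_inf" "u \<in> S_inf"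
  shows "skew_dd u w (- P) = - skew_dd u w P"
  using skew_dd_add[OF assms, of P "- P"] skew_dd_0[OF assms]
  by (simp add: eq_neg_iff_add_eq_0 add.commute)

text \<open>The recurrence read for \<open>t s\<^sub>i\<close>, which makes sense also if \<open>t s\<^sub>i\<close> is shorter than \<open>t\<close>.\<close>

lemma skew_dd_step_shift:
  assumes u: "u \<in> S_inf" and t: "t \<in> S_inf" and i: "1 \<le> i"
  shows "skew_dd u t (dd i P) + (if u (Suc i) < u i then skew_dd (u \<circ> s i) t (act (s i) P) else 0) =
    (if t i < t (Suc i) then skew_dd u (t \<circ> s i) P else 0)"
proof (cases "t i < t (Suc i)")
  case True
  then have "(t \<circ> s i) (Suc i) < (t \<circ> s i) i" by (simp add: s_apply)
  then show ?thesis
    using skew_dd_step[of u "t \<circ> s i" i P] assms True by (simp del: o_apply)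
next
  case False
  then have d: "t (Suc i) < t i" using S_inf_neq[OF t, of i] by simp
  \<comment> \<open>Expand both terms along the descent \<open>i\<close> of \<open>t\<close>. Since
    \<open>dd i\<close> kills \<open>dd i P\<close>, what survives is present only if
    \<open>i\<close> is a descent of \<open>u\<close>, and it cancels because \<open>s i\<close>
    fixes \<open>dd i P\<close> whereas \<open>dd i (act (s i) P) = - dd i P\<close>.\<close>
  have "\<not> (u \<circ> s i) (Suc i) < (u \<circ> s i) i" if "u (Suc i) < u i"
    using that by (simp add: s_apply)
  then show ?thesis
    using assms False d skew_dd_step[of u t i "dd i P"] skew_dd_step[of "u \<circ> s i" t i "act (s i) P"]
    by (simp add: skew_dd_0 skew_dd_uminus act_s_dd_same dd_act_same del: o_apply)
qed

text \<open>The case \<open>u = id\<close> is \<open>leibniz\<close>. For general \<open>u\<close>,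
  the recurrence yields two terms containing \<open>P\<close> differentiated or permuted;
  \<open>skew_dd_step_shift\<close> merges them into one.\<close>

lemma skew_dd_mult:
  assumes "w \<in> S_inf" "u \<in> S_inf"
  shows "skew_dd u w (P * Q) =
    (\<Sum>t | t \<in> S_inf \<and> skew_dd t w \<noteq> (\<lambda>P. 0). skew_dd u t P * skew_dd t w Q)"
  using assms
proof (induction w arbitrary: u P Q rule: descent_induct)
  case id
  have "id \<noteq> (\<lambda>P. 0 :: mpoly_int)" by (metis id_apply zero_neq_one)
  then have "{t \<in> S_inf. skew_dd t id \<noteq> (\<lambda>P. 0)} = {id}"
    using skew_dd_not_id skew_dd_id id_in_S_inf by (auto simp del: id_apply)
  moreover have "id P = P" for P :: mpoly_int by simp
  ultimately show ?case
    using id by (cases "u = id") (simp_all add: skew_dd_id skew_dd_not_id del: id_apply)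
next
  case (descent w i)
  let ?v = "w \<circ> s i" and ?r = "\<lambda>t :: nat \<Rightarrow> nat. t \<circ> s i"
  let ?S = "\<lambda>w. {t \<in> S_inf. skew_dd t w \<noteq> (\<lambda>P. 0)}"
  note w = descent.hyps and u = descent.prems
  have v: "?v \<in> S_inf" and ru: "?r u \<in> S_inf" using w u by simp_all
  \<comment> \<open>A finite set closed under \<open>t \<mapsto> t \<circ> s i\<close> that contains
    both supports, so that all sums share one index set and can be reindexed.\<close>
  define A where "A = (?S w \<union> ?S ?v) \<union> ?r ` (?S w \<union> ?S ?v)"
  have A: "finite A" "A \<subseteq> S_inf"
    using leibniz(1)[OF w(1)] leibniz(1)[OF v] w(2) by (auto simp: A_def)
  have rA: "?r t \<in> A" if "t \<in> A" for t
    using that comp_s_s[of _ i] unfolding A_def by (auto simp del: o_apply)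
  have IH: "skew_dd u ?v (P * Q) = (\<Sum>t\<in>A. skew_dd u t P * skew_dd t ?v Q)"
    if "u \<in> S_inf" for u P Q
    unfolding descent.IH[OF that]
    by (rule sum.mono_neutral_left) (use A in \<open>auto simp: A_def\<close>)
  have "skew_dd u w (P * Q) = skew_dd u ?v (P * dd i Q) + skew_dd u ?v (dd i P * act (s i) Q) +
      (if u (Suc i) < u i then skew_dd (?r u) ?v (act (s i) P * act (s i) Q) else 0)"
    using skew_dd_step[OF u w, of "P * Q"] v u by (simp add: dd_mult act_mult skew_dd_add del: o_apply)
  also have "\<dots> = (\<Sum>t\<in>A. skew_dd u t P * skew_dd t ?v (dd i Q)) +
      (\<Sum>t\<in>A. (skew_dd u t (dd i P) +
        (if u (Suc i) < u i then skew_dd (?r u) t (act (s i) P) else 0)) * skew_dd t ?v (act (s i) Q))"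
    using u ru by (simp add: IH distrib_right sum.distrib del: o_apply)
  also have "\<dots> = (\<Sum>t\<in>A. skew_dd u t P * skew_dd t ?v (dd i Q)) +
      (\<Sum>t\<in>A. (if t i < t (Suc i) then skew_dd u (?r t) P else 0) * skew_dd t ?v (act (s i) Q))"
    using A u w by (intro arg_cong2[where f = "(+)"] sum.cong refl arg_cong2[where f = "(*)"]
        skew_dd_step_shift) auto
  \<comment> \<open>Replacing \<open>t\<close> by \<open>t \<circ> s i\<close> turns ascents at
    \<open>i\<close> into descents; the two sums then combine to the recurrence for
    \<open>skew_dd t w Q\<close>.\<close>
  also have "(\<Sum>t\<in>A. (if t i < t (Suc i) then skew_dd u (?r t) P else 0) * skew_dd t ?v (act (s i) Q)) =
      (\<Sum>t\<in>A. (if t (Suc i) < t i then skew_dd u t P else 0) * skew_dd (?r t) ?v (act (s i) Q))"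
    by (rule sum.reindex_bij_witness[where i = ?r and j = ?r])
      (use rA in \<open>auto simp: s_apply comp_assoc\<close>)
  also have "(\<Sum>t\<in>A. skew_dd u t P * skew_dd t ?v (dd i Q)) + \<dots> = (\<Sum>t\<in>A. skew_dd u t P * skew_dd t w Q)"
    unfolding sum.distrib[symmetric]
    by (rule sum.cong) (use A w in \<open>auto simp: skew_dd_step distrib_left simp del: o_apply\<close>)
  also have "\<dots> = (\<Sum>t\<in>?S w. skew_dd u t P * skew_dd t w Q)"
    by (rule sum.mono_neutral_right) (use A in \<open>auto simp: A_def\<close>)
  finally show ?case .
qed

section \<open>Polynomials with nonnegative coefficients\<close>

definition nonneg :: "mpoly_int \<Rightarrow> bool" where
  "nonneg P \<longleftrightarrow> (\<forall>m. Poly_Mapping.lookup P m \<ge> 0)"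

lemma nonneg_0: "nonneg 0"
  by (simp add: nonneg_def)

lemma nonneg_1: "nonneg 1"
  by (simp add: nonneg_def lookup_one when_def)

lemma nonneg_X: "nonneg (X i)"
  by (simp add: nonneg_def X_def lookup_single when_def)

lemma nonneg_add: "nonneg P \<Longrightarrow> nonneg Q \<Longrightarrow> nonneg (P + Q)"
  by (simp add: nonneg_def lookup_add)

lemma nonneg_mult: "nonneg P \<Longrightarrow> nonneg Q \<Longrightarrow> nonneg (P * Q)"
  by (simp add: nonneg_def times_poly_mapping.rep_eq prod_fun_def Sum_any.expand_set sum_nonneg when_def)

lemma nonneg_sum: "(\<And>t. t \<in> A \<Longrightarrow> nonneg (f t)) \<Longrightarrow> nonneg (sum f A)"
  by (induction A rule: infinite_finite_induct) (simp_all add: nonneg_0 nonneg_add)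

lemma nonneg_prod: "(\<And>t. t \<in> A \<Longrightarrow> nonneg (f t)) \<Longrightarrow> nonneg (prod f A)"
  by (induction A rule: infinite_finite_induct) (simp_all add: nonneg_1 nonneg_mult)

lemma nonneg_act: "bij u \<Longrightarrow> nonneg P \<Longrightarrow> nonneg (act u P)"
  by (simp add: nonneg_def lookup_act)

section \<open>Skew divided differences of square-free monomials\<close>

lemma act_prod_X:
  assumes "bij u"
  shows "act u (prod X A) = prod X (u ` A)"
proof -
  have "act u (prod X A) = (\<Prod>j\<in>A. X (u j))"
    by (induction A rule: infinite_finite_induct) (simp_all add: act_1 act_mult act_X assms)
  also have "\<dots> = prod X (u ` A)"
    using inj_on_subset[OF bij_is_inj[OF assms] subset_UNIV] by (simp add: prod.reindex)
  finally show ?thesis .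
qed

lemma s_image_same: "(i \<in> A \<longleftrightarrow> Suc i \<in> A) \<Longrightarrow> s i ` A = A"
  unfolding s_def by (rule transpose_image_eq)

lemma dd_prod_X_same: "(i \<in> A \<longleftrightarrow> Suc i \<in> A) \<Longrightarrow> dd i (prod X A) = 0"
  by (rule dd_unique) (simp add: act_prod_X s_image_same)

text \<open>The cofactor of \<open>X i\<close> is fixed by \<open>s i\<close>, and
  \<open>dd i (X i) = 1\<close>.\<close>

lemma dd_prod_X_in:
  assumes "finite A" "i \<in> A" "Suc i \<notin> A"
  shows "dd i (prod X A) = prod X (A - {i})"
proof (rule dd_unique)
  have "act (s i) (prod X (A - {i})) = prod X (A - {i})"
    using assms by (simp add: act_prod_X s_image_same)
  moreover have "prod X A = X i * prod X (A - {i})"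
    using assms by (simp add: prod.remove)
  ultimately show "(X i - X (Suc i)) * prod X (A - {i}) = prod X A - act (s i) (prod X A)"
    by (simp add: act_mult act_X s_apply left_diff_distrib)
qed

text \<open>Left-to-right maxima are never preceded by a descent, so no \<open>dd i\<close> acts on
  \<open>X (Suc i)\<close>. The condition on \<open>A\<close> is chosen because it survives both
  branches of the recurrence.\<close>

lemma nonneg_skew_dd_prod_X:
  assumes "w \<in> S_inf" "u \<in> S_inf" "finite A" "\<And>p q. p < q \<Longrightarrow> q \<in> A \<Longrightarrow> w p < w q"
  shows "nonneg (skew_dd u w (prod X A))"
  using assms
proof (induction w arbitrary: u A rule: descent_induct)
  case id
  have "id P = P" for P :: mpoly_int by simp
  with id show ?case
    by (cases "u = id")
      (simp_all add: skew_dd_id skew_dd_not_id nonneg_0 nonneg_prod nonneg_X del: id_apply)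
next
  case (descent w i)
  note w = descent.hyps and u = descent.prems(1) and incr = descent.prems(3)
  have ru: "u \<circ> s i \<in> S_inf" using u w by simp
  have Suc_i: "Suc i \<notin> A" using incr[of i "Suc i"] w by auto
  \<comment> \<open>Only the pair \<open>(i, Suc i)\<close> has its order reversed by
    \<open>s i\<close>, and there \<open>w \<circ> s i\<close> increases since \<open>i\<close> is a
    descent of \<open>w\<close>.\<close>
  have incr': "(w \<circ> s i) p < (w \<circ> s i) q" if "p < q" "q \<in> s i ` A" for p q
  proof (cases "p = i \<and> q = Suc i")
    case True
    then show ?thesis using w by (simp add: s_apply)
  next
    case False
    then have "s i p < s i q" using \<open>p < q\<close> by (auto simp: s_apply)
    moreover have "s i q \<in> A" using \<open>q \<in> s i ` A\<close> by auto
    ultimately show ?thesis using incr by simp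
  qed
  have act: "nonneg (skew_dd (u \<circ> s i) (w \<circ> s i) (act (s i) (prod X A)))"
    unfolding act_prod_X[OF bij_s]
    by (rule descent.IH[OF ru]) (use descent.prems(2) incr' in auto)
  have "nonneg (skew_dd u (w \<circ> s i) (dd i (prod X A)))"
  proof (cases "i \<in> A")
    case True
    have "(w \<circ> s i) p < (w \<circ> s i) q" if "p < q" "q \<in> A - {i}" for p q
    proof -
      have "s i q = q" using that Suc_i by (auto simp: s_apply)
      then have "q \<in> s i ` A" using that by (metis DiffD1 imageI)
      then show ?thesis using incr' that by blast
    qed
    then show ?thesis
      unfolding dd_prod_X_in[OF descent.prems(2) True Suc_i]
      by (intro descent.IH u) (use descent.prems(2) in auto)
  next
    case False
    then show ?thesis using Suc_i u w by (simp add: dd_prod_X_same skew_dd_0 nonneg_0)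
  qed
  then show ?case
    unfolding skew_dd_step[OF u w] using act by (simp add: nonneg_add nonneg_0)
qed

text \<open>Induction on the length leaves the choice of the descent free, so that one different
  from \<open>k\<close> can be taken whenever it exists.\<close>

lemma nonneg_skew_dd_initial:
  assumes "w \<in> S_inf" "u \<in> S_inf"
  shows "nonneg (skew_dd u w (prod X {1..k}))"
  using assms
proof (induction "len w" arbitrary: u w rule: less_induct)
  case less
  note w = less.prems(1) and u = less.prems(2)
  show ?case
  proof (cases "\<exists>i\<ge>1. i \<noteq> k \<and> w (Suc i) < w i")
    case True
    then obtain i where i: "1 \<le> i" "i \<noteq> k" "w (Suc i) < w i" by blast
    then have sym: "i \<in> {1..k} \<longleftrightarrow> Suc i \<in> {1..k}" by auto
    have "nonneg (skew_dd (u \<circ> s i) (w \<circ> s i) (prod X {1..k}))"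
      using less.hyps[of "w \<circ> s i" "u \<circ> s i"] i w u by (simp add: len_s_less_iff)
    then show ?thesis
      unfolding skew_dd_step[OF u w i(1,3)] dd_prod_X_same[OF sym] act_prod_X[OF bij_s] s_image_same[OF sym]
      using w u i by (simp add: skew_dd_0 nonneg_0)
  next
    case False
    have asc: "w i < w (Suc i)" if "i < k" for i
    proof (cases "i = 0")
      \<comment> \<open>Index \<open>0\<close> matters because the condition in
        \<open>nonneg_skew_dd_prod_X\<close> ranges over all \<open>p < q\<close>, including
        \<open>p = 0\<close>.\<close>
      case True
      then show ?thesis using S_inf_zero[OF w] S_inf_pos[OF w, of 1] by simp
    next
      case pos: False
      then show ?thesis using False that S_inf_neq[OF w, of i]
        by (metis less_one linorder_neqE_nat nat_neq_iff not_le)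
    qed
    have "w p < w q" if "p < q" "q \<in> {1..k}" for p q
    proof -
      have "Suc p \<le> q" using that by simp
      then show ?thesis using \<open>q \<in> {1..k}\<close>
      proof (induction q rule: dec_induct)
        case base
        then show ?case using asc[of p] by simp
      next
        case (step q)
        then show ?case using asc[of q] by fastforce
      qed
    qed
    then show ?thesis using nonneg_skew_dd_prod_X[OF w u] by blast
  qed
qed

section \<open>The staircase monomial\<close>

lemma schubert_w0_0: "schubert_w0 0 = 1"
  by (simp add: schubert_w0_def)

lemma schubert_w0_Suc: "schubert_w0 (Suc n) = schubert_w0 n * prod X {1..Suc n}"
proof -
  \<comment> \<open>At \<open>i = Suc n\<close> the exponent \<open>n + 1 - i\<close> is 0, so
    \<open>schubert_w0 n\<close> may be written as a product up to \<open>Suc n\<close>.\<close>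
  have "schubert_w0 (Suc n) = (\<Prod>i=1..Suc n. X i ^ (n + 1 - i) * X i)"
    unfolding schubert_w0_def by (rule prod.cong) (simp_all add: Suc_diff_le)
  then show ?thesis by (simp add: prod.distrib schubert_w0_def)
qed

lemma schubert_w0_Zx: "schubert_w0 n \<in> Zx"
proof (induction n)
  case (Suc n)
  have "prod X A \<in> Zx" if "A \<subseteq> {1..}" for A
    using that by (induction A rule: infinite_finite_induct) (auto intro: Zx_mult)
  then have "prod X {1..Suc n} \<in> Zx" by (metis atLeastAtMost_iff atLeast_iff subsetI)
  then show ?case unfolding schubert_w0_Suc using Suc by (rule Zx_mult[rotated])
qed (simp add: schubert_w0_0)

lemma nonneg_skew_dd_schubert_w0:
  assumes "w \<in> S_inf" "u \<in> S_inf"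
  shows "nonneg (skew_dd u w (schubert_w0 n))"
  using assms
\<comment> \<open>The Leibniz rule applies \<open>skew_dd u t\<close> with varying \<open>t\<close>
  to the smaller staircase, so the upper permutation has to be arbitrary.\<close>
proof (induction n arbitrary: u w)
  case 0
  then show ?case using nonneg_skew_dd_initial[of w u 0] by (simp add: schubert_w0_0)
next
  case (Suc n)
  then show ?case
    unfolding schubert_w0_Suc skew_dd_mult[OF Suc.prems]
    by (intro nonneg_sum nonneg_mult nonneg_skew_dd_initial) auto
qed

theorem theorem5p2:
  fixes n :: nat and u w :: "nat \<Rightarrow> nat"
  assumes "n \<ge> 1" and "u \<in> S_inf" and "w \<in> S_inf"
  shows "skew_schubert u w n \<in> Zx \<and>
    (\<forall>m. Poly_Mapping.lookup (skew_schubert u w n) m \<ge> 0)"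
proof -
  have "skew_dd u w (schubert_w0 n) \<in> Zx" and "nonneg (skew_dd u w (schubert_w0 n))"
    using assms by (simp_all add: skew_dd_Zx schubert_w0_Zx nonneg_skew_dd_schubert_w0)
  then have "skew_schubert u w n \<in> Zx" and "nonneg (skew_schubert u w n)"
    unfolding skew_schubert_def using S_inf_inv[OF assms(2)]
    by (simp_all add: Zx_act nonneg_act S_inf_bij)
  then show ?thesis by (simp add: nonneg_def)
qed

end
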